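(* If $m,k\in\mathbb{N}_0$, $m\le k$, and $x\in(-1,1)$, then, for either choice of sign (all upper signs together, or all lower signs together), the following mutually inverse relations hold: $$\frac{P_k^{\mp m}(x)}{2^{\pm m}}=\frac{k!\,(1-x)^{\frac k2}}{(1+x)^{\frac k2\pm m}}\sum_{n=m\mp m}^{2k}\frac{\mathcal{G}_n\left(-k\mp m,-k\pm m,\sqrt{\frac{1-x}{1+x}}\right)}{(-1)^{n+k}(2k-n)!}\,\frac{P_{k\pm m}^{k\mp m-n}\left(\frac1x\right)}{x^{-k\mp m}},$$ $$\frac{P_k^{\mp m}\left(\frac1x\right)}{2^{\pm m}x^{-k}}=\frac{k!\,(1-x)^{\frac k2}}{(1+x)^{\frac k2\pm m}}\sum_{n=m\mp m}^{2k}\frac{\widehat{\mathcal{G}}_n\left(-k\mp m,-k\pm m,\sqrt{\frac{1-x}{1+x}}\right)}{(-1)^{n+k}(2k-n)!}\,P_{k\pm m}^{k\mp m-n}(x).$$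
   Context: $\mathbb{N}_0=\{0,1,2,\dots\}$. The functions $\mathcal{G}_n(\tau,\rho,w)$ and $\widehat{\mathcal{G}}_n(\tau,\rho,\eta)$ are the Maclaurin coefficients $$(1-wz)^{\tau}\left(1+\frac zw\right)^{-\tau}(1+z^2)^{-\rho}=\sum_{n=0}^\infty\mathcal{G}_n(\tau,\rho,w)z^n,$$ $$(1+\eta\zeta)^{\tau}\left(1+\frac\zeta\eta\right)^{-\tau}(1-\zeta^2)^{-\rho}=\sum_{n=0}^\infty\widehat{\mathcal{G}}_n(\tau,\rho,\eta)\zeta^n,$$ for small $|z|,|\zeta|$, each factor being $1$ at $0$. $P_k^{\pm m}$ ($k,m\in\mathbb{N}_0$) are the associated Legendre polynomials, given for $k\ge m$ by $$P_k^{m}(x)=(-1)^m\frac{(k+m)!}{(k-m)!}P_k^{-m}(x)=\frac{(-1)^m(2m)!}{2^m m!}\,|1-x^2|^{\frac m2}\,C_{k-m}^{m+1/2}(x),$$ and $P_k^m(x)=0$ for $k<m$. Here $C_k^{\tau}(x)=\frac{1}{\Gamma(\tau)}\sum_{j=0}^{[k/2]}\frac{(-1)^j\Gamma(k-j+\tau)}{j!\,(k-2j)!}(2x)^{k-2j}$ is the Gegenbauer polynomial and $[\cdot]$ is the integer part.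
   Formalization: For |y|>1, P_k^{±m}(y) is the standard function off the cut: factor (y-1)^{m/2}(y+1)^{m/2} replaces (-1)^m|1-y^2|^{m/2}, and P_k^{-m}=(k-m)!/(k+m)! P_k^m with no sign (the given formula fails at k=1, m=0); at x=0, P(1/x)/x^{-degree} is its limit. *)

theory Defs
  imports "HOL-Analysis.Analysis"
begin

text \<open>Maclaurin coefficients; all bases are positive near \<open>0\<close> when \<open>w, \<eta> > 0\<close>, so each factor is
  the branch of the power that equals \<open>1\<close> at \<open>0\<close>.\<close>

definition maclaurin_coeff :: "nat \<Rightarrow> (real \<Rightarrow> real) \<Rightarrow> real" where
  "maclaurin_coeff n f = (deriv ^^ n) f 0 / fact n"

definition G :: "nat \<Rightarrow> real \<Rightarrow> real \<Rightarrow> real \<Rightarrow> real" where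
  "G n \<tau> \<rho> w = maclaurin_coeff n
     (\<lambda>z. (1 - w * z) powr \<tau> * (1 + z / w) powr (- \<tau>) * (1 + z\<^sup>2) powr (- \<rho>))"

definition G_hat :: "nat \<Rightarrow> real \<Rightarrow> real \<Rightarrow> real \<Rightarrow> real" where
  "G_hat n \<tau> \<rho> \<eta> = maclaurin_coeff n
     (\<lambda>z. (1 + \<eta> * z) powr \<tau> * (1 + z / \<eta>) powr (- \<tau>) * (1 - z\<^sup>2) powr (- \<rho>))"

definition gegenbauer :: "nat \<Rightarrow> real \<Rightarrow> real \<Rightarrow> real" where
  "gegenbauer k \<tau> x = 1 / Gamma \<tau> *
     (\<Sum>j\<le>k div 2. (- 1) ^ j * Gamma (real k - real j + \<tau>) / (fact j * fact (k - 2 * j))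
                      * (2 * x) ^ (k - 2 * j))"

text \<open>Branch conventions for the associated Legendre functions. On \<open>[-1, 1]\<close> they are the Ferrers
  functions, with the factor \<open>(-1)\<^sup>m \<bar>1 - x\<^sup>2\<bar>\<^bsup>m/2\<^esup>\<close>. Off that interval they are the usual functions of the
  complex plane cut along it: the factor is \<open>(x - 1)\<^bsup>m/2\<^esup> (x + 1)\<^bsup>m/2\<^esup>\<close> with principal powers, which has
  modulus \<open>\<bar>1 - x\<^sup>2\<bar>\<^bsup>m/2\<^esup>\<close>, no sign \<open>(-1)\<^sup>m\<close> for \<open>x > 1\<close>, and the sign \<open>(-1)\<^sup>m\<close> for \<open>x < -1\<close>; in addition
  the orders \<open>m\<close> and \<open>-m\<close> are then related without a sign. Keeping the Ferrers phase outside
  \<open>[-1, 1]\<close> would make the relations between arguments \<open>x\<close> and \<open>1/x\<close> false, already for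
  degree \<open>1\<close> and order \<open>0\<close>.\<close>

definition legendre_phase :: "real \<Rightarrow> real" where
  "legendre_phase x = (if \<bar>x\<bar> \<le> 1 then - 1 else 1)"

definition legendre_root :: "real \<Rightarrow> real" where
  "legendre_root x = (if x < - 1 then - sqrt \<bar>1 - x\<^sup>2\<bar> else sqrt \<bar>1 - x\<^sup>2\<bar>)"

definition assoc_legendre_nonneg :: "nat \<Rightarrow> nat \<Rightarrow> real \<Rightarrow> real" where
  "assoc_legendre_nonneg k m x =
     (if k < m then 0
      else legendre_phase x ^ m * fact (2 * m) / (2 ^ m * fact m) * legendre_root x ^ m
             * gegenbauer (k - m) (real m + 1 / 2) x)"

definition assoc_legendre :: "nat \<Rightarrow> int \<Rightarrow> real \<Rightarrow> real" where
  "assoc_legendre k \<mu> x =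
     (let m = nat \<bar>\<mu>\<bar> in
      if \<mu> \<ge> 0 then assoc_legendre_nonneg k m x
      else legendre_phase x ^ m * fact (k - m) / fact (k + m) * assoc_legendre_nonneg k m x)"

text \<open>The quotient \<open>P\<^sub>k\<^sup>\<mu>(1/x) / x\<^bsup>-k\<^esup>\<close>, read at \<open>x = 0\<close> as its limit.\<close>

definition assoc_legendre_recip :: "nat \<Rightarrow> int \<Rightarrow> real \<Rightarrow> real" where
  "assoc_legendre_recip k \<mu> x =
     (if x = 0 then Lim (at 0) (\<lambda>t. assoc_legendre k \<mu> (1 / t) / t powi (- int k))
      else assoc_legendre k \<mu> (1 / x) / x powi (- int k))"

end

theory Submission imports Defs "HOL-Complex_Analysis.Laurent_Convergence"
begin

text \<open>
  Both relations are coefficient extractions from one product of generating functions.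

  For fixed degree \<open>l\<close> and argument \<open>y\<close> the associated Legendre functions of all orders
  \<open>-l, \<dots>, l\<close> are, up to factorials, the coefficients of the \<open>l\<close>-th power of one quadratic, the
  Legendre kernel:
  \<open>(r + 2 y t + p r t\<^sup>2)\<^sup>l = 2\<^sup>l l! (\<Sum>j\<le>2 l. P\<^sub>l\<^bsup>j-l\<^esup>(y) t\<^sup>j / j!)\<close>.
  Here \<open>r\<close> is the root factor and \<open>p\<close> the phase, so that \<open>p r\<^sup>2 = y\<^sup>2 - 1\<close>. This is Rodrigues' formula read
  as a Taylor expansion of \<open>((y + h)\<^sup>2 - 1)\<^sup>l\<close> at \<open>h = p r t\<close>; for negative orders it follows from the
  symmetry of the quadratic under \<open>t \<mapsto> 1 / (p t)\<close>. At the argument \<open>1/x\<close>, multiplying by \<open>x\<^sup>l\<close>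
  turns the kernel into \<open>(r + 2 t + r t\<^sup>2)\<^sup>l\<close> with \<open>r = sqrt (1 - x\<^sup>2)\<close>, which is continuous in \<open>x\<close>
  and hence covers the limit at \<open>x = 0\<close> as well (\<open>assoc_legendre_eq_coeff\<close>,
  \<open>assoc_legendre_recip_eq_coeff\<close>).

  Put \<open>w = sqrt ((1 - x) / (1 + x))\<close>, \<open>c = 1 + x\<close>, \<open>l = k + s m\<close>, \<open>q = k - s m\<close>, and let \<open>e = 1\<close> for
  the argument \<open>x\<close>, \<open>e = -1\<close> for \<open>1/x\<close>. The kernels then factor as \<open>c (w + t) (1 - e w t)\<close>, while the
  generating function of the \<open>G\<close> that is paired with this kernel is
  \<open>(1 + e w t)\<^bsup>-l\<^esup> (1 + t/w)\<^sup>l (1 - e t\<^sup>2)\<^sup>q\<close>. The sum on the right-hand side is a Cauchy product: it is the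
  coefficient of \<open>t\<^bsup>2k\<^esup>\<close> in this series times the \<open>l\<close>-th power of the kernel at \<open>-t\<close>. In the product the
  negative power cancels and an even polynomial remains,
  \<open>(c w)\<^sup>l (1 - t\<^sup>2/w\<^sup>2)\<^sup>l (1 - e t\<^sup>2)\<^sup>q\<close> (\<open>G_fps_times_kernel\<close>). Finally \<open>l + q = 2 k\<close>, and therefore
  exchanging binomial coefficients identifies its middle coefficient, up to elementary factors, with that of
  \<open>t\<^sup>q\<close> in \<open>((w + t) (1 + e w t))\<^sup>k\<close> (\<open>coeff_exchange\<close>). The latter is the kernel of degree \<open>k\<close> with the
  opposite sign \<open>e\<close>, that is, the Legendre function at the other argument.
\<close>

section \<open>The generating polynomial of the associated Legendre functions\<close>

lemma Gamma_nat_plus_half: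
  "Gamma (real n + 1 / 2) = fact (2 * n) / (4 ^ n * fact n) * sqrt pi"
proof (induction n)
  case 0
  then show ?case by (simp add: Gamma_one_half_real)
next
  case (Suc n)
  have "Gamma (real (Suc n) + 1 / 2) = (real n + 1 / 2) * Gamma (real n + 1 / 2)"
  proof -
    have "real n + 1 / 2 \<notin> \<int>\<^sub>\<le>\<^sub>0"
      using nonpos_Ints_nonpos[of "real n + 1 / 2"] by linarith
    from Gamma_plus1[OF this] show ?thesis by (simp add: add_ac)
  qed
  also have "\<dots> = (2 * real n + 2) * (2 * real n + 1) * fact (2 * n) / (4 * 4 ^ n * ((real n + 1) * fact n)) * sqrt pi"
    unfolding Suc.IH by (simp add: divide_simps) (simp add: algebra_simps)
  finally show ?case by (simp add: algebra_simps)
qed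

text \<open>Rodrigues' formula: the left-hand side is the derivative of order \<open>l + m\<close> of \<open>(y\<^sup>2 - 1)\<^sup>l\<close>, written as
  a Taylor coefficient of \<open>((y + h)\<^sup>2 - 1)\<^sup>l\<close> in \<open>h\<close>. Expanding by powers of \<open>(y + h)\<^sup>2\<close> gives the
  Gegenbauer sum term by term, because Gamma at half-integers is a quotient of factorials.\<close>

lemma gegenbauer_eq_coeff:
  assumes "m \<le> l"
  shows "fact (l + m) * coeff ([:y\<^sup>2 - 1, 2 * y, 1:] ^ l) (l + m) =
    2 ^ l * fact l * fact (2 * m) / (2 ^ m * fact m) * gegenbauer (l - m) (real m + 1 / 2) y"
proof -
  define N where "N = (l - m) div 2"
  have "[:y\<^sup>2 - 1, 2 * y, 1:] = [:-1:] + [:y, 1:] ^ 2"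
    by (simp add: power2_eq_square)
  then have "[:y\<^sup>2 - 1, 2 * y, 1:] ^ l
      = (\<Sum>i\<le>l. of_nat (l choose i) * [:-1:] ^ i * ([:y, 1:] ^ 2) ^ (l - i))"
    by (simp only: binomial_ring)
  also have "\<dots> = (\<Sum>i\<le>l. smult (real (l choose i) * (-1) ^ i) ([:y, 1:] ^ (2 * (l - i))))"
    by (intro sum.cong) (simp_all add: poly_const_pow of_nat_poly mult.commute flip: power_mult)
  finally have "coeff ([:y\<^sup>2 - 1, 2 * y, 1:] ^ l) (l + m)
      = (\<Sum>i\<le>l. real (l choose i) * (-1) ^ i * coeff ([:y, 1:] ^ (2 * (l - i))) (l + m))"
    by (simp add: coeff_sum)
  \<comment> \<open>For \<open>i > N\<close> the degree \<open>2 (l - i)\<close> is less than \<open>l + m\<close>.\<close>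
  also have "\<dots> = (\<Sum>i\<le>N. real (l choose i) * (-1) ^ i * coeff ([:y, 1:] ^ (2 * (l - i))) (l + m))"
  proof (rule sum.mono_neutral_right)
    show "\<forall>i\<in>{..l} - {..N}. real (l choose i) * (- 1) ^ i * coeff ([:y, 1:] ^ (2 * (l - i))) (l + m) = 0"
      using assms by (auto simp: N_def degree_linear_power intro!: coeff_eq_0)
  qed (auto simp: N_def)
  also have "fact (l + m) * \<dots> = (\<Sum>i\<le>N. fact (l + m) * (real (l choose i) * (-1) ^ i * coeff ([:y, 1:] ^ (2 * (l - i))) (l + m)))"
    by (rule sum_distrib_left)
  also have "\<dots> = (\<Sum>i\<le>N. 2 ^ l * fact l * fact (2 * m) / (2 ^ m * fact m) * (1 / Gamma (real m + 1 / 2) *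
      ((- 1) ^ i * Gamma (real (l - m) - real i + (real m + 1 / 2)) / (fact i * fact (l - m - 2 * i)) * (2 * y) ^ (l - m - 2 * i))))"
  proof (intro sum.cong refl)
    fix i assume "i \<in> {..N}"
    then have "2 * i \<le> l - m" by (auto simp: N_def)
    then obtain d where d: "l - m = 2 * i + d"
      using le_Suc_ex by blast
    have l: "l = m + 2 * i + d" using d assms by simp
    have G: "Gamma (real (l - m) - real i + (real m + 1 / 2)) = Gamma (real (l - i) + 1 / 2)"
      by (simp add: l algebra_simps)
    have li: "l - i = m + i + d" by (simp add: l)
    have p4: "(4::real) ^ n = 2 ^ n * 2 ^ n" for n
      by (simp flip: power_mult_distrib)
    have c: "coeff ([:y, 1:] ^ (2 * (m + i + d))) (l + m) = real (2 * (m + i + d) choose (l + m)) * y ^ d"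
      by (subst coeff_linear_poly_power) (simp_all add: l)
    have b1: "real (l choose i) = fact l / (fact i * fact (m + i + d))"
      using binomial_fact[of i l, where 'a = real] li by (simp add: l add_ac)
    have b2: "real (2 * (m + i + d) choose (l + m)) = fact (2 * (m + i + d)) / (fact (l + m) * fact d)"
      using binomial_fact[of "l + m" "2 * (m + i + d)"] by (simp add: l)
    have dd: "l - m - 2 * i = d" using d by simp
    have two: "(2::real) ^ l = 2 ^ m * 2 ^ i * 2 ^ i * 2 ^ d"
      by (simp add: l power_add mult_2)
    show "fact (l + m) * (real (l choose i) * (- 1) ^ i * coeff ([:y, 1:] ^ (2 * (l - i))) (l + m)) =
      2 ^ l * fact l * fact (2 * m) / (2 ^ m * fact m) * (1 / Gamma (real m + 1 / 2) *
      ((- 1) ^ i * Gamma (real (l - m) - real i + (real m + 1 / 2)) / (fact i * fact (l - m - 2 * i)) * (2 * y) ^ (l - m - 2 * i)))"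
      unfolding G c dd li b1 b2 Gamma_nat_plus_half two p4 power_mult_distrib power_add
      by (simp add: field_simps)
  qed
  also have "\<dots> = 2 ^ l * fact l * fact (2 * m) / (2 ^ m * fact m) * gegenbauer (l - m) (real m + 1 / 2) y"
    unfolding gegenbauer_def N_def by (simp only: sum_distrib_left)
  finally show ?thesis .
qed

lemma pcompose_power:
  fixes a b :: "'a::comm_semiring_1 poly"
  shows "pcompose (a ^ n) b = pcompose a b ^ n"
  by (induction n) (simp_all add: pcompose_mult pcompose_1)

text \<open>Since \<open>p = 1/p\<close>, reversing the coefficients of the kernel amounts to the substitution
  \<open>t \<mapsto> p t\<close> and a factor \<open>p\<close>. The relation between orders \<open>m\<close> and \<open>-m\<close> has the same form.\<close>

lemma legendre_kernel_coeff_symmetric: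
  fixes p R y :: real
  assumes "p * p = 1" "R \<noteq> 0" "m \<le> l"
  shows "coeff ([:R, 2 * y, p * R:] ^ l) (l - m) = p ^ m * coeff ([:R, 2 * y, p * R:] ^ l) (l + m)"
proof -
  have p0: "p \<noteq> 0" using assms(1) by auto
  define K where "K = [:R, 2 * y, p * R:]"
  have deg: "degree (K ^ l) = 2 * l"
    using assms(2) p0 by (simp add: K_def degree_power_eq)
  have "reflect_poly K = [:p * R, 2 * y, R:]"
    using assms(2) p0 by (simp add: K_def reflect_poly_def cCons_def)
  also have "\<dots> = smult p (pcompose K [:0, p:])"
    using assms(1) by (simp add: K_def pcompose_pCons algebra_simps)
  finally have "reflect_poly (K ^ l) = smult (p ^ l) (pcompose (K ^ l) [:0, p:])"
    by (simp add: reflect_poly_power smult_power pcompose_power)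
  then have "coeff (reflect_poly (K ^ l)) (l + m) = p ^ l * (p ^ (l + m) * coeff (K ^ l) (l + m))"
    by (simp add: coeff_pcompose_linear)
  also have "coeff (reflect_poly (K ^ l)) (l + m) = coeff (K ^ l) (l - m)"
    using assms(3) by (simp add: coeff_reflect_poly deg)
  also have "p ^ l * (p ^ (l + m) * coeff (K ^ l) (l + m)) = (p * p) ^ l * (p ^ m * coeff (K ^ l) (l + m))"
    unfolding power_add power_mult_distrib by (simp only: mult_ac)
  finally show ?thesis by (simp add: assms(1) K_def)
qed

text \<open>The generating function in \<open>t\<close> of all orders. The substitution \<open>h = p R t\<close> turns
  \<open>(y + h)\<^sup>2 - 1\<close> into \<open>p R\<close> times the kernel; the points \<open>y = 1\<close> and \<open>y = -1\<close> are excluded because there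
  \<open>R = 0\<close> and the substitution degenerates.\<close>

lemma assoc_legendre_eq_coeff:
  assumes "j \<le> 2 * l" and "\<bar>y\<bar> \<noteq> 1"
  shows "assoc_legendre l (int j - int l) y = fact j / (2 ^ l * fact l) *
    coeff ([:legendre_root y, 2 * y, legendre_phase y * legendre_root y:] ^ l) j"
proof -
  define p where "p = legendre_phase y"
  define R where "R = legendre_root y"
  define K where "K = [:R, 2 * y, p * R:] ^ l"
  have pp: "p * p = 1" by (simp add: p_def legendre_phase_def)
  have pR: "p * R\<^sup>2 = y\<^sup>2 - 1"
  proof (cases "\<bar>y\<bar> \<le> 1")
    case True
    then show ?thesis by (auto simp: p_def R_def legendre_phase_def legendre_root_def abs_square_le_1)
  next
    case False
    then have "y\<^sup>2 > 1" using abs_square_le_1[of y] by simp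
    then show ?thesis using False by (auto simp: p_def R_def legendre_phase_def legendre_root_def)
  qed
  have "y\<^sup>2 \<noteq> 1" using assms(2) by (simp add: abs_square_eq_1)
  then have R0: "R \<noteq> 0" and p0: "p \<noteq> 0" using pR by auto
  have nonneg: "assoc_legendre_nonneg l m y = fact (l + m) / (2 ^ l * fact l) * coeff K (l + m)"
    if "m \<le> l" for m
  proof -
    have "pcompose [:y\<^sup>2 - 1, 2 * y, 1:] [:0, p * R:] = smult (p * R) [:R, 2 * y, p * R:]"
      using pR by (simp add: pcompose_pCons power2_eq_square algebra_simps)
    then have "pcompose ([:y\<^sup>2 - 1, 2 * y, 1:] ^ l) [:0, p * R:] = smult ((p * R) ^ l) K"
      by (simp only: pcompose_power smult_power K_def)
    then have "(p * R) ^ (l + m) * coeff ([:y\<^sup>2 - 1, 2 * y, 1:] ^ l) (l + m) = (p * R) ^ l * coeff K (l + m)"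
      by (metis coeff_pcompose_linear coeff_smult)
    then have K: "coeff K (l + m) = (p * R) ^ m * coeff ([:y\<^sup>2 - 1, 2 * y, 1:] ^ l) (l + m)"
      using R0 p0 by (simp add: power_add)
    have "fact (l + m) * coeff K (l + m) = (p * R) ^ m * 
      (2 ^ l * fact l * fact (2 * m) / (2 ^ m * fact m) * gegenbauer (l - m) (real m + 1 / 2) y)"
      unfolding K gegenbauer_eq_coeff[OF that, symmetric] by (simp only: mult_ac)
    then show ?thesis
      using that unfolding assoc_legendre_nonneg_def p_def R_def
      by (simp add: power_mult_distrib)
  qed
  show ?thesis
  proof (cases "l \<le> j")
    case True
    then obtain m where "j = l + m" using le_Suc_ex by blast
    with assms(1) nonneg[of m] show ?thesis
      by (simp add: assoc_legendre_def K_def p_def R_def)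
  next
    case False
    define m where "m = l - j"
    have j: "j = l - m" and m: "m \<le> l" "m > 0" using False by (auto simp: m_def)
    have i: "int j - int l = - int m" using m by (simp add: j)
    have "assoc_legendre l (- int m) y = p ^ m * fact (l - m) / fact (l + m) * assoc_legendre_nonneg l m y"
      using m by (simp add: assoc_legendre_def p_def)
    also have "\<dots> = fact (l - m) / (2 ^ l * fact l) * (p ^ m * coeff K (l + m))"
      unfolding nonneg[OF m(1)] by simp
    also have "p ^ m * coeff K (l + m) = coeff K (l - m)"
      unfolding K_def by (rule legendre_kernel_coeff_symmetric[OF pp R0 m(1), symmetric])
    finally show ?thesis by (simp add: i K_def p_def R_def flip: j)
  qed
qed

lemma tendsto_coeff_power:
  fixes f :: "'b \<Rightarrow> 'a::{real_normed_algebra, comm_semiring_1} poly"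
  assumes "\<And>i. ((\<lambda>t. coeff (f t) i) \<longlongrightarrow> coeff p i) F"
  shows "((\<lambda>t. coeff (f t ^ n) j) \<longlongrightarrow> coeff (p ^ n) j) F"
proof (induction n arbitrary: j)
  case 0
  then show ?case by simp
next
  case (Suc n)
  then show ?case by (auto simp: coeff_mult intro!: tendsto_sum tendsto_mult assms)
qed

text \<open>For \<open>x \<noteq> 0\<close> the factor \<open>x\<^sup>l\<close> is absorbed into the kernel at \<open>1/x\<close>; the sign that
  \<open>legendre_root\<close> has below \<open>-1\<close> is what makes \<open>x * legendre_root (1/x)\<close> equal to \<open>sqrt (1 - x\<^sup>2)\<close> for
  negative \<open>x\<close> too. The result is continuous at \<open>0\<close>, so it also holds there.\<close>

lemma assoc_legendre_recip_eq_coeff: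
  assumes "j \<le> 2 * l" and "\<bar>x\<bar> < 1"
  shows "assoc_legendre_recip l (int j - int l) x = fact j / (2 ^ l * fact l) *
    coeff ([:sqrt (1 - x\<^sup>2), 2, sqrt (1 - x\<^sup>2):] ^ l) j"
proof -
  have nz: "assoc_legendre l (int j - int l) (1 / t) / t powi (- int l) = fact j / (2 ^ l * fact l) *
    coeff ([:sqrt (1 - t\<^sup>2), 2, sqrt (1 - t\<^sup>2):] ^ l) j" if "\<bar>t\<bar> < 1" "t \<noteq> 0" for t
  proof -
    define R where "R = legendre_root (1 / t)"
    have t1: "\<bar>1 / t\<bar> > 1" using that by (simp add: field_simps)
    have t2: "t\<^sup>2 < 1" using that by (simp add: abs_square_less_1)
    have "\<bar>1 - (1 / t)\<^sup>2\<bar> = (1 - t\<^sup>2) / t\<^sup>2"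
      using that t2 by (simp add: field_simps abs_if)
    then have "sqrt \<bar>1 - (1 / t)\<^sup>2\<bar> = sqrt (1 - t\<^sup>2) / \<bar>t\<bar>"
      by (simp add: real_sqrt_divide)
    moreover have "1 / t < - 1 \<longleftrightarrow> t < 0"
      using that by (cases "t > 0") (auto simp: field_simps)
    ultimately have tR: "t * R = sqrt (1 - t\<^sup>2)"
      using that by (auto simp: R_def legendre_root_def)
    have "assoc_legendre l (int j - int l) (1 / t) = fact j / (2 ^ l * fact l) * coeff ([:R, 2 * (1 / t), R:] ^ l) j"
      using assoc_legendre_eq_coeff[OF assms(1), of "1 / t"] t1
      by (simp only: R_def legendre_phase_def) (auto simp: not_le)
    moreover have "[:sqrt (1 - t\<^sup>2), 2, sqrt (1 - t\<^sup>2):] ^ l = smult (t ^ l) ([:R, 2 * (1 / t), R:] ^ l)"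
      unfolding smult_power[symmetric] using that by (simp add: tR)
    ultimately show ?thesis by (simp add: power_int_minus field_simps)
  qed
  show ?thesis
  proof (cases "x = 0")
    case False
    then show ?thesis using nz assms(2) by (simp add: assoc_legendre_recip_def)
  next
    case True
    have "((\<lambda>t. fact j / (2 ^ l * fact l) * coeff ([:sqrt (1 - t\<^sup>2), 2, sqrt (1 - t\<^sup>2):] ^ l) j)
        \<longlongrightarrow> fact j / (2 ^ l * fact l) * coeff ([:sqrt (1 - 0\<^sup>2), 2, sqrt (1 - 0\<^sup>2):] ^ l) j) (at (0::real))"
    proof (intro tendsto_mult_left tendsto_coeff_power)
      have "((\<lambda>t. sqrt (1 - t\<^sup>2)) \<longlongrightarrow> sqrt (1 - 0\<^sup>2)) (at (0::real))"
        by (intro tendsto_intros)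
      then show "((\<lambda>t. coeff [:sqrt (1 - t\<^sup>2), 2, sqrt (1 - t\<^sup>2):] i)
        \<longlongrightarrow> coeff [:sqrt (1 - 0\<^sup>2), 2, sqrt (1 - 0\<^sup>2):] i) (at (0::real))" for i
        by (auto simp: coeff_pCons split: nat.splits)
    qed
    moreover have "\<forall>\<^sub>F t in at (0::real). fact j / (2 ^ l * fact l) * coeff ([:sqrt (1 - t\<^sup>2), 2, sqrt (1 - t\<^sup>2):] ^ l) j
        = assoc_legendre l (int j - int l) (1 / t) / t powi (- int l)"
      unfolding eventually_at by (intro exI[of _ 1]) (use nz in auto)
    ultimately have "((\<lambda>t. assoc_legendre l (int j - int l) (1 / t) / t powi (- int l))
        \<longlongrightarrow> fact j / (2 ^ l * fact l) * coeff ([:sqrt (1 - 0\<^sup>2), 2, sqrt (1 - 0\<^sup>2):] ^ l) j) (at (0::real))"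
      by (rule Lim_transform_eventually)
    then show ?thesis
      using True by (simp add: assoc_legendre_recip_def tendsto_Lim)
  qed
qed

section \<open>The generating series of the Maclaurin coefficients\<close>

lemma higher_deriv_eq_fps_nth:
  fixes f :: "'a::{banach, real_normed_field} \<Rightarrow> 'a"
  assumes "f has_fps_expansion F"
  shows "(deriv ^^ n) f 0 = fact n * fps_nth F n"
  using assms
proof (induction n arbitrary: f F)
  case 0
  then show ?case by (auto simp: has_fps_expansion_def eval_fps_at_0 dest: eventually_nhds_x_imp_x)
next
  case (Suc n)
  have "(deriv ^^ Suc n) f 0 = (deriv ^^ n) (deriv f) 0"
    by (simp add: funpow_Suc_right del: funpow.simps)
  also have "\<dots> = fact n * fps_nth (fps_deriv F) n"
    by (intro Suc.IH has_fps_expansion_deriv Suc.prems)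
  finally show ?case by (simp add: algebra_simps)
qed


text \<open>The exponents \<open>\<tau> = -l\<close> and \<open>\<rho> = -q\<close> that occur are non-positive integers, so both generating functions
  are rational; \<open>e = -1\<close> belongs to \<open>G\<close> and \<open>e = 1\<close> to \<open>G_hat\<close>.\<close>

definition G_fps :: "real \<Rightarrow> real \<Rightarrow> nat \<Rightarrow> nat \<Rightarrow> real fps" where
  "G_fps e w l q = inverse (1 + fps_const (e * w) * fps_X) ^ l
     * (1 + fps_const (1 / w) * fps_X) ^ l * (1 - fps_const e * fps_X ^ 2) ^ q"

lemma maclaurin_coeff_eq_G_fps:
  "maclaurin_coeff n (\<lambda>z. (1 + e * w * z) powr (- real l) * (1 + z / w) powr real l
     * (1 - e * z\<^sup>2) powr real q) = fps_nth (G_fps e w l q) n" (is "maclaurin_coeff n ?f = _")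
proof -
  define g where "g = (\<lambda>z. inverse (1 + e * w * z) ^ l * (1 + 1 / w * z) ^ l * (1 - e * z ^ 2) ^ q)"
  have "\<forall>\<^sub>F z in nhds 0. 1 + e * w * z > 0"
    by (rule order_tendstoD) (rule tendsto_eq_intros refl filterlim_ident | simp)+
  moreover have "\<forall>\<^sub>F z in nhds 0. 1 + 1 / w * z > 0"
    by (rule order_tendstoD) (rule tendsto_eq_intros refl filterlim_ident | simp)+
  moreover have "\<forall>\<^sub>F z in nhds 0. 1 - e * z ^ 2 > 0"
    by (rule order_tendstoD) (rule tendsto_eq_intros refl filterlim_ident | simp)+
  ultimately have ev: "\<forall>\<^sub>F z in nhds 0. g z = ?f z"
    by eventually_elim (simp add: g_def powr_realpow powr_minus power_inverse)
  have "g has_fps_expansion G_fps e w l q"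
    unfolding g_def G_fps_def
    by (intro has_fps_expansion_mult has_fps_expansion_power has_fps_expansion_inverse has_fps_expansion_add
        has_fps_expansion_diff has_fps_expansion_cmult_left fps_expansion_intros) simp
  then have "?f has_fps_expansion G_fps e w l q"
    unfolding has_fps_expansion_def using ev by (auto elim: eventually_elim2)
  then show ?thesis
    unfolding maclaurin_coeff_def by (subst higher_deriv_eq_fps_nth) simp_all
qed

lemma G_eq_G_fps: "G n (- real l) (- real q) w = fps_nth (G_fps (- 1) w l q) n"
  unfolding G_def maclaurin_coeff_eq_G_fps[symmetric] by simp

lemma G_hat_eq_G_fps: "G_hat n (- real l) (- real q) w = fps_nth (G_fps 1 w l q) n"
  unfolding G_hat_def maclaurin_coeff_eq_G_fps[symmetric] by simp


section \<open>The product with the Legendre kernel\<close>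

lemma coeff_linear_poly_power_all:
  "coeff ([:a, b:] ^ n) i = of_nat (n choose i) * b ^ i * a ^ (n - i)" for a b :: "'a::comm_semiring_1"
proof (cases "i \<le> n")
  case True
  then show ?thesis by (rule coeff_linear_poly_power)
next
  case False
  have "degree ([:a, b:] ^ n) \<le> degree [:a, b:] * n"
    by (rule degree_power_le)
  also have "\<dots> \<le> 1 * n" by (intro mult_right_mono) simp_all
  finally show ?thesis using False by (simp add: coeff_eq_0 binomial_eq_0)
qed

text \<open>At \<open>-t\<close> the kernel is \<open>(w - t) (1 + e w t)\<close>: its second factor cancels the negative power in the
  series, and its first factor completes \<open>1 + t/w\<close> to \<open>1 - t\<^sup>2/w\<^sup>2\<close>. Hence the product is a function of \<open>t\<^sup>2\<close>.\<close>

lemma G_fps_times_kernel: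
  assumes "w \<noteq> 0"
  shows "G_fps e w l q * fps_of_poly (pcompose (([:w, 1:] * [:1, - (e * w):]) ^ l) [:0, - 1:])
    = fps_const (w ^ l) * (fps_of_poly ([:1, - (1 / w\<^sup>2):] ^ l * [:1, - e:] ^ q) oo fps_X ^ 2)"
proof -
  have "pcompose (([:w, 1:] * [:1, - (e * w):]) ^ l) [:0, - 1:] = [:w, -1:] ^ l * [:1, e * w:] ^ l"
    unfolding pcompose_power pcompose_mult power_mult_distrib by (simp add: pcompose_pCons)
  moreover have "fps_of_poly [:w, - 1:] = fps_const w * (1 - fps_const (1 / w) * fps_X)"
    using assms by (simp add: fps_of_poly_pCons algebra_simps flip: mult.assoc)
  moreover have "fps_of_poly [:1, e * w:] = 1 + fps_const (e * w) * fps_X"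
    by (rule fps_of_poly_linear')
  ultimately have "G_fps e w l q * fps_of_poly (pcompose (([:w, 1:] * [:1, - (e * w):]) ^ l) [:0, - 1:])
    = fps_const w ^ l * (inverse (1 + fps_const (e * w) * fps_X) * (1 + fps_const (e * w) * fps_X)) ^ l
     * ((1 + fps_const (1 / w) * fps_X) * (1 - fps_const (1 / w) * fps_X)) ^ l * (1 - fps_const e * fps_X ^ 2) ^ q"
    by (simp only: G_fps_def fps_of_poly_mult fps_of_poly_power power_mult_distrib mult_ac)
  also have "inverse (1 + fps_const (e * w) * fps_X) * (1 + fps_const (e * w) * fps_X) = 1"
    by (rule inverse_mult_eq_1) simp
  also have "(1 + fps_const (1 / w) * fps_X) * (1 - fps_const (1 / w) * fps_X) = 1 - fps_const (1 / w\<^sup>2) * fps_X ^ 2"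
  proof -
    have "fps_const (1 / w\<^sup>2) = fps_const (1 / w) * fps_const (1 / w)"
      by (simp add: power2_eq_square)
    then show ?thesis by (simp only:) (simp add: algebra_simps power2_eq_square del: fps_const_mult)
  qed
  also have "1 - fps_const (1 / w\<^sup>2) * fps_X ^ 2 = fps_of_poly [:1, - (1 / w\<^sup>2):] oo fps_X ^ 2"
    by (simp add: fps_of_poly_linear' fps_compose_add_distrib fps_compose_sub_distrib fps_compose_mult_distrib flip: fps_const_neg)
  also have "1 - fps_const e * fps_X ^ 2 = fps_of_poly [:1, - e:] oo fps_X ^ 2"
    by (simp add: fps_of_poly_linear' fps_compose_add_distrib fps_compose_sub_distrib fps_compose_mult_distrib flip: fps_const_neg)
  finally show ?thesis
    by (simp add: fps_of_poly_mult fps_of_poly_power fps_compose_mult_distrib fps_compose_power fps_const_power mult.assoc)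
qed

text \<open>Both sides are sums over \<open>i \<le> min k q\<close>, and they agree term by term because \<open>l + q = 2 k\<close> implies
  \<open>k!\<^sup>2 binom(l, k - i) binom(q, i) = l! q! binom(k, i) binom(k, q - i)\<close>: after division by
  \<open>k!\<^sup>2 l! q!\<close> both are the reciprocal of \<open>i! (k - i)! (q - i)! (l - k + i)!\<close>. Where \<open>l - k + i\<close> is
  negative, both vanish.\<close>

lemma coeff_exchange:
  fixes w e :: real
  assumes "l + q = 2 * k" "w \<noteq> 0"
  shows "fact k * fact k * w ^ (k + l) * coeff ([:1, - (1 / w\<^sup>2):] ^ l * [:1, - e:] ^ q) k
    = (- 1) ^ k * fact l * fact q * coeff (([:w, 1:] * [:1, e * w:]) ^ k) q"
proof -
  define f where "f i = fact k * fact k * w ^ (k + l) * 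
      (real (q choose i) * (- e) ^ i * (real (l choose (k - i)) * (- (1 / w\<^sup>2)) ^ (k - i)))" for i
  define g where "g i = (- 1) ^ k * fact l * fact q *
      (real (k choose i) * (e * w) ^ i * (real (k choose (q - i)) * w ^ (k - (q - i))))" for i
  have "fact k * fact k * w ^ (k + l) * coeff ([:1, - e:] ^ q * [:1, - (1 / w\<^sup>2):] ^ l) k = (\<Sum>i\<le>k. f i)"
    by (simp only: coeff_mult coeff_linear_poly_power_all f_def sum_distrib_left power_one mult_1_right)
  also have "\<dots> = (\<Sum>i\<le>min k q. f i)"
    by (intro sum.mono_neutral_right) (auto simp: f_def binomial_eq_0)
  also have "\<dots> = (\<Sum>i\<le>min k q. g i)"
  proof (intro sum.cong refl)
    fix i assume "i \<in> {..min k q}"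
    then have "i \<le> k" "i \<le> q" by auto
    then obtain a b where k: "k = a + i" and q: "q = b + i"
      by (metis add.commute le_Suc_ex)
    show "f i = g i"
    proof (cases "a \<le> l")
      case False
      then have "b > k" using assms(1) k q by simp
      with False show ?thesis by (simp add: f_def g_def k q binomial_eq_0)
    next
      case True
      then obtain d where l: "l = a + d" using le_Suc_ex by blast
      have d: "a + i = b + d" using assms(1) by (simp add: k q l)
      have idx: "k - i = a" "q - i = b" "k - b = d" using d by (simp_all add: k q)
      have B: "real (q choose i) = fact q / (fact b * fact i)" "real (l choose a) = fact l / (fact a * fact d)"
        "real (k choose i) = fact k / (fact a * fact i)" "real (k choose b) = fact k / (fact b * fact d)"
        using binomial_fact[of i q, where 'a = real] binomial_fact[of a l, where 'a = real]
          binomial_fact[of i k, where 'a = real] binomial_fact[of b k, where 'a = real] d idx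
        by (simp_all add: k q l mult.commute)
      have "w ^ (k + l) = w ^ a * w ^ a * w ^ i * w ^ d" by (simp add: k l power_add)
      then have W: "w ^ (k + l) * ((- e) ^ i * (- (1 / w\<^sup>2)) ^ a) = (- 1) ^ k * ((e * w) ^ i * w ^ d)"
        using assms(2) power_minus[of e i] power_minus[of "1 / w\<^sup>2" a]
        by (simp add: k power_add power_divide power_mult_distrib power2_eq_square)
      have "f i = fact k * fact k * fact q * fact l / (fact b * fact i * fact a * fact d) * (w ^ (k + l) * ((- e) ^ i * (- (1 / w\<^sup>2)) ^ a))"
        unfolding f_def idx B by (simp add: mult_ac)
      also have "\<dots> = g i"
        unfolding W g_def idx B by (simp add: mult_ac)
      finally show ?thesis .
    qed
  qed
  also have "\<dots> = (\<Sum>i\<le>q. g i)"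
    by (intro sum.mono_neutral_left) (auto simp: g_def binomial_eq_0)
  also have "\<dots> = (- 1) ^ k * fact l * fact q * coeff ([:1, e * w:] ^ k * [:w, 1:] ^ k) q"
    by (simp only: coeff_mult coeff_linear_poly_power_all g_def sum_distrib_left power_one mult_1_right mult_1_left)
  finally show ?thesis by (simp only: power_mult_distrib mult.commute)
qed

text \<open>The common form of \<open>P\<^sub>l\<^bsup>j-l\<^esup>(x)\<close> (for \<open>e = 1\<close>) and \<open>x\<^sup>l P\<^sub>l\<^bsup>j-l\<^esup>(1/x)\<close> (for \<open>e = -1\<close>) when
  \<open>c = 1 + x\<close> and \<open>w = sqrt ((1 - x) / (1 + x))\<close>.\<close>

definition legendre_coeff :: "real \<Rightarrow> real \<Rightarrow> real \<Rightarrow> nat \<Rightarrow> nat \<Rightarrow> real" where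
  "legendre_coeff e c w l j = fact j / (2 ^ l * fact l) * c ^ l * coeff (([:w, 1:] * [:1, - (e * w):]) ^ l) j"

text \<open>The two relations at once. In a \<open>legendre_coeff\<close> the factor \<open>j!\<close> cancels the \<open>(2 k - n)!\<close> at
  \<open>j = 2 k - n\<close>, and \<open>(-1)\<^sup>n = (-1)\<^bsup>2k-n\<^esup>\<close> moves to the kernel, where it replaces \<open>t\<close> by \<open>-t\<close>. What remains is the
  Cauchy product for the coefficient of \<open>t\<^bsup>2k\<^esup>\<close>; its terms with \<open>n < 2 k - 2 l\<close> vanish since the
  kernel power has degree at most \<open>2 l\<close>.\<close>

lemma G_fps_legendre_sum:
  assumes "l + q = 2 * k" "w \<noteq> 0" "c \<noteq> 0"
  shows "legendre_coeff (- e) c w k q / (2 ^ l / 2 ^ k) = fact k * (w ^ k * c ^ k / c ^ l) *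
    (\<Sum>n = 2 * k - 2 * l..2 * k. fps_nth (G_fps e w l q) n / ((- 1) ^ (n + k) * fact (2 * k - n))
       * legendre_coeff e c w l (2 * k - n))"
proof -
  define K where "K = ([:w, 1:] * [:1, - (e * w):]) ^ l"
  have "degree [:w, 1:] + degree [:1, - (e * w):] \<le> 2" by simp
  then have "degree ([:w, 1:] * [:1, - (e * w):]) \<le> 2"
    using degree_mult_le order_trans by blast
  then have deg: "degree K \<le> 2 * l"
    unfolding K_def by (meson degree_power_le mult_le_mono1 order_trans)
  define A where "A = c ^ l / (2 ^ l * fact l) * (- 1) ^ k"
  have "(\<Sum>n = 2 * k - 2 * l..2 * k. fps_nth (G_fps e w l q) n / ((- 1) ^ (n + k) * fact (2 * k - n))
       * legendre_coeff e c w l (2 * k - n))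
     = (\<Sum>n = 2 * k - 2 * l..2 * k. A * (fps_nth (G_fps e w l q) n * ((- 1) ^ (2 * k - n) * coeff K (2 * k - n))))"
  proof (intro sum.cong refl)
    fix n assume "n \<in> {2 * k - 2 * l..2 * k}"
    then have "even (2 * k - n) \<longleftrightarrow> even n" by auto
    then have "(- 1 :: real) ^ (2 * k - n) = (- 1) ^ n"
      by (auto simp: minus_one_power_iff)
    moreover have "x / ((- 1) ^ (n + k)) = x * (- 1) ^ k * (- 1) ^ n" for x :: real
      by (auto simp: minus_one_power_iff)
    ultimately show "fps_nth (G_fps e w l q) n / ((- 1) ^ (n + k) * fact (2 * k - n))
       * legendre_coeff e c w l (2 * k - n) = A * (fps_nth (G_fps e w l q) n * ((- 1) ^ (2 * k - n) * coeff K (2 * k - n)))"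
      unfolding A_def legendre_coeff_def K_def[symmetric] divide_divide_eq_left[symmetric] by simp
  qed
  also have "\<dots> = A * (\<Sum>n = 2 * k - 2 * l..2 * k. fps_nth (G_fps e w l q) n * ((- 1) ^ (2 * k - n) * coeff K (2 * k - n)))"
    by (simp only: sum_distrib_left)
  also have "(\<Sum>n = 2 * k - 2 * l..2 * k. fps_nth (G_fps e w l q) n * ((- 1) ^ (2 * k - n) * coeff K (2 * k - n)))
     = (\<Sum>n = 0..2 * k. fps_nth (G_fps e w l q) n * ((- 1) ^ (2 * k - n) * coeff K (2 * k - n)))"
    using deg by (intro sum.mono_neutral_left) (auto intro!: coeff_eq_0)
  also have "\<dots> = fps_nth (G_fps e w l q * fps_of_poly (pcompose K [:0, - 1:])) (2 * k)"
    by (simp only: fps_mult_nth fps_of_poly_nth coeff_pcompose_linear)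
  also have "\<dots> = w ^ l * coeff ([:1, - (1 / w\<^sup>2):] ^ l * [:1, - e:] ^ q) k"
    unfolding K_def G_fps_times_kernel[OF assms(2)]
    by (simp only: fps_mult_left_const_nth fps_nth_compose_X_power fps_of_poly_nth) simp
  finally have "fact k * (w ^ k * c ^ k / c ^ l) * (\<Sum>n = 2 * k - 2 * l..2 * k. fps_nth (G_fps e w l q) n / ((- 1) ^ (n + k) * fact (2 * k - n))
       * legendre_coeff e c w l (2 * k - n))
    = c ^ k * (- 1) ^ k / (2 ^ l * fact l * fact k) * (fact k * fact k * w ^ (k + l) * coeff ([:1, - (1 / w\<^sup>2):] ^ l * [:1, - e:] ^ q) k)"
    using assms(3) by (simp add: A_def power_add)
  also have "\<dots> = legendre_coeff (- e) c w k q / (2 ^ l / 2 ^ k)"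
    unfolding coeff_exchange[OF assms(1,2)] by (simp add: legendre_coeff_def mult_ac)
  finally show ?thesis ..
qed

section \<open>Specialization to the associated Legendre functions\<close>

text \<open>With \<open>c = 1 + x\<close> the definition of \<open>w\<close> gives \<open>c w = sqrt (1 - x\<^sup>2)\<close> and \<open>c w\<^sup>2 = 1 - x\<close>, hence
  \<open>c (1 - w\<^sup>2) = 2 x\<close> and \<open>c (1 + w\<^sup>2) = 2\<close>. The factors \<open>1 * w\<close> and \<open>- 1 * w\<close> display the sign \<open>e\<close>.\<close>

lemma legendre_kernel_factorization:
  assumes "- 1 < x" "x < 1"
  defines "w \<equiv> sqrt ((1 - x) / (1 + x))"
  shows "[:sqrt (1 - x\<^sup>2), 2 * x, - sqrt (1 - x\<^sup>2):] = smult (1 + x) ([:w, 1:] * [:1, - (1 * w):])"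
    and "[:sqrt (1 - x\<^sup>2), 2, sqrt (1 - x\<^sup>2):] = smult (1 + x) ([:w, 1:] * [:1, - (- 1 * w):])"
proof -
  have "sqrt (1 - x\<^sup>2) = sqrt ((1 + x)\<^sup>2 * ((1 - x) / (1 + x)))"
    using assms by (simp add: power2_eq_square field_simps)
  also have "\<dots> = (1 + x) * w"
    using assms(1) unfolding w_def real_sqrt_mult by simp
  finally have r: "sqrt (1 - x\<^sup>2) = (1 + x) * w" .
  have "w * w = (1 - x) / (1 + x)"
    using assms by (simp add: w_def)
  then have ww: "(1 + x) * (w * w) = 1 - x" using assms by simp
  show "[:sqrt (1 - x\<^sup>2), 2 * x, - sqrt (1 - x\<^sup>2):] = smult (1 + x) ([:w, 1:] * [:1, - (1 * w):])"
    "[:sqrt (1 - x\<^sup>2), 2, sqrt (1 - x\<^sup>2):] = smult (1 + x) ([:w, 1:] * [:1, - (- 1 * w):])"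
    using ww by (simp_all add: r algebra_simps)
qed

lemma assoc_legendre_eq_legendre_coeff:
  assumes "- 1 < x" "x < 1" "j \<le> 2 * l"
  defines "w \<equiv> sqrt ((1 - x) / (1 + x))"
  shows "assoc_legendre l (int j - int l) x = legendre_coeff 1 (1 + x) w l j"
    and "assoc_legendre_recip l (int j - int l) x = legendre_coeff (- 1) (1 + x) w l j"
proof -
  have root: "legendre_root x = sqrt (1 - x\<^sup>2)" and phase: "legendre_phase x * sqrt (1 - x\<^sup>2) = - sqrt (1 - x\<^sup>2)"
    using assms(1,2) by (simp_all add: legendre_root_def legendre_phase_def abs_square_le_1)
  note kernel = legendre_kernel_factorization[OF assms(1,2), folded w_def]
  have "\<bar>x\<bar> \<noteq> 1" and x1: "\<bar>x\<bar> < 1" using assms(1,2) by auto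
  from assoc_legendre_eq_coeff[OF assms(3) this(1)]
  show "assoc_legendre l (int j - int l) x = legendre_coeff 1 (1 + x) w l j"
    unfolding root phase kernel(1) legendre_coeff_def by (simp only: smult_power coeff_smult mult.assoc)
  from assoc_legendre_recip_eq_coeff[OF assms(3) x1]
  show "assoc_legendre_recip l (int j - int l) x = legendre_coeff (- 1) (1 + x) w l j"
    unfolding kernel(2) legendre_coeff_def by (simp only: smult_power coeff_smult mult.assoc)
qed



theorem corollary18:
  fixes m k :: nat and x :: real and s :: int
  assumes "m \<le> k" and "- 1 < x" and "x < 1"
    and sign: "s = 1 \<or> s = - 1"
  shows
    "assoc_legendre k (- s * int m) x / 2 powi (s * int m) =
       fact k * (1 - x) powr (real k / 2) / (1 + x) powr (real k / 2 + of_int s * real m) *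
       (\<Sum>n = nat (int m - s * int m)..2 * k.
          G n (- real k - of_int s * real m) (- real k + of_int s * real m) (sqrt ((1 - x) / (1 + x)))
            / ((- 1) ^ (n + k) * fact (2 * k - n))
          * assoc_legendre_recip (nat (int k + s * int m)) (int k - s * int m - int n) x)
     \<and>
     assoc_legendre_recip k (- s * int m) x / 2 powi (s * int m) =
       fact k * (1 - x) powr (real k / 2) / (1 + x) powr (real k / 2 + of_int s * real m) *
       (\<Sum>n = nat (int m - s * int m)..2 * k.
          G_hat n (- real k - of_int s * real m) (- real k + of_int s * real m) (sqrt ((1 - x) / (1 + x)))
            / ((- 1) ^ (n + k) * fact (2 * k - n))
          * assoc_legendre (nat (int k + s * int m)) (int k - s * int m - int n) x)"
proof -
  define l where "l = nat (int k + s * int m)"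
  define q where "q = nat (int k - s * int m)"
  define c where "c = 1 + x"
  define w where "w = sqrt ((1 - x) / (1 + x))"
  have l: "int l = int k + s * int m" and q: "int q = int k - s * int m"
    using sign assms(1) by (auto simp: l_def q_def)
  have lq: "l + q = 2 * k" using l q by linarith
  have lr: "of_int s * real m = real l - real k" and qr: "- real k + of_int s * real m = - real q"
    using arg_cong[OF l, of real_of_int] arg_cong[OF q, of real_of_int] by simp_all
  \<comment> \<open>For \<open>s = 1\<close> both sides are \<open>0\<close>, the right-hand side by truncated subtraction.\<close>
  have s0: "nat (int m - s * int m) = 2 * k - 2 * l"
    using sign assms(1) by (auto simp: l_def)
  have w: "w > 0" and c: "c > 0" using assms by (simp_all add: w_def c_def)
  \<comment> \<open>The half-integer powers in the prefactor combine to integer powers of \<open>w\<close> and \<open>c\<close>.\<close>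
  have wc: "1 - x = w\<^sup>2 * c"
    using assms by (simp add: w_def c_def)
  have pre: "(1 - x) powr (real k / 2) / (1 + x) powr (real k / 2 + of_int s * real m) = w ^ k * c ^ k / c ^ l"
  proof -
    have "w\<^sup>2 powr (real k / 2) = (w powr 2) powr (real k / 2)"
      using w by simp
    also have "\<dots> = w powr real k"
      unfolding powr_powr by simp
    finally have "w\<^sup>2 powr (real k / 2) = w ^ k"
      using w by (simp only: powr_realpow)
    moreover have "c powr (real k / 2) * c powr (real k / 2) = c ^ k"
      using c by (simp add: powr_realpow flip: powr_add)
    ultimately show ?thesis
      unfolding lr wc c_def[symmetric] using w c
      by (simp add: powr_mult powr_add powr_diff powr_realpow)
  qed
  have two: "2 powi (s * int m) = (2 ^ l / 2 ^ k :: real)"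
  proof -
    have "s * int m = int l - int k" using l by simp
    then show ?thesis by (simp add: power_int_diff)
  qed
  have lhs: "- s * int m = int q - int k" using q by simp
  have q2: "q \<le> 2 * k" using lq by simp
  note eqs = assoc_legendre_eq_legendre_coeff[OF assms(2,3), folded w_def c_def]
  have terms: "assoc_legendre l (int k - s * int m - int n) x = legendre_coeff 1 c w l (2 * k - n)"
    "assoc_legendre_recip l (int k - s * int m - int n) x = legendre_coeff (- 1) c w l (2 * k - n)"
    if "n \<in> {2 * k - 2 * l..2 * k}" for n
  proof -
    have j: "2 * k - n \<le> 2 * l" and idx: "int k - s * int m - int n = int (2 * k - n) - int l"
      using that l by auto
    show "assoc_legendre l (int k - s * int m - int n) x = legendre_coeff 1 c w l (2 * k - n)"
      "assoc_legendre_recip l (int k - s * int m - int n) x = legendre_coeff (- 1) c w l (2 * k - n)"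
      unfolding idx by (fact eqs[OF j])+
  qed
  have tau: "- real k - of_int s * real m = - real l" using lr by simp
  show ?thesis
    unfolding tau qr s0 two lhs w_def[symmetric] l_def[symmetric] eqs[OF q2] G_eq_G_fps G_hat_eq_G_fps

  proof (intro conjI)
    show "legendre_coeff 1 c w k q / (2 ^ l / 2 ^ k) =
      fact k * (1 - x) powr (real k / 2) / (1 + x) powr (real k / 2 + of_int s * real m) *
       (\<Sum>n = 2 * k - 2 * l..2 * k. fps_nth (G_fps (- 1) w l q) n / ((- 1) ^ (n + k) * fact (2 * k - n))
          * assoc_legendre_recip l (int k - s * int m - int n) x)"
      unfolding times_divide_eq_right[symmetric] pre
      using G_fps_legendre_sum[OF lq, of w c "- 1"] w c
      by (simp only: terms(2) cong: sum.cong) simp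
    show "legendre_coeff (- 1) c w k q / (2 ^ l / 2 ^ k) =
      fact k * (1 - x) powr (real k / 2) / (1 + x) powr (real k / 2 + of_int s * real m) *
       (\<Sum>n = 2 * k - 2 * l..2 * k. fps_nth (G_fps 1 w l q) n / ((- 1) ^ (n + k) * fact (2 * k - n))
          * assoc_legendre l (int k - s * int m - int n) x)"
      unfolding times_divide_eq_right[symmetric] pre
      using G_fps_legendre_sum[OF lq, of w c 1] w c
      by (simp only: terms(1) cong: sum.cong) simp
  qed
qed

end
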